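(* Let $K,L$ be convex bodies in $\mathbb{R}^n$ and let $\nu\in\mathbb{S}^{n-1}$. Then $$h_{\nu,K+L}=h_{\nu,K}\ \overline{\square}_p\ h_{\nu,L},$$ that is, for all $u\in\nu^\perp$ and $p\in\mathbb{R}$, $$h_{\nu,K+L}(u,p)=\sup_{p_1+p_2=p}\bigl\{h_{\nu,K}(u,p_1)+h_{\nu,L}(u,p_2)\bigr\}.$$
   Context: $K+L=\{x+y: x\in K,\ y\in L\}$ is the Minkowski sum. For a unit vector $\nu\in\mathbb{S}^{n-1}$ write $\nu^\perp=\{x\in\mathbb{R}^n: x\cdot\nu=0\}$. The slicing support function of a convex body $K$ along $\nu$ is $h_{\nu,K}(u,p)=\sup\{x\cdot u: x\in K,\ x\cdot\nu=p\}$ for $u\in\nu^\perp$, $p\in\mathbb{R}$, with value $-\infty$ if $\{x\in K: x\cdot\nu=p\}$ is empty. The partial supremal convolution in the $p$-variable is $(h_{\nu,K}\,\overline{\square}_p\,h_{\nu,L})(u,p):=\sup_{p_1+p_2=p}\{h_{\nu,K}(u,p_1)+h_{\nu,L}(u,p_2)\}$, the supremum being over all $p_1,p_2\in\mathbb{R}$ with $p_1+p_2=p$ (a sum with a term $-\infty$ equals $-\infty$). *)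

theory Defs
  imports "HOL-Analysis.Analysis" "HOL-Library.Set_Algebras"
begin

text \<open>Bodies with empty interior are included. The Minkowski sum is the set addition \<open>+\<close> of
  \<^theory>\<open>HOL-Library.Set_Algebras\<close>.\<close>

definition convex_body :: "(real ^ 'n) set \<Rightarrow> bool" where
  "convex_body K \<longleftrightarrow> K \<noteq> {} \<and> compact K \<and> convex K"

definition orth_hyperplane :: "real ^ 'n \<Rightarrow> (real ^ 'n) set" where
  "orth_hyperplane \<nu> = {x. x \<bullet> \<nu> = 0}"

text \<open>In \<^typ>\<open>ereal\<close> the supremum of the empty set is \<open>-\<infinity>\<close>, so an empty slice gets the
  value \<open>-\<infinity>\<close>.\<close>

definition slicing_support :: "real ^ 'n \<Rightarrow> (real ^ 'n) set \<Rightarrow> real ^ 'n \<Rightarrow> real \<Rightarrow> ereal" where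
  "slicing_support \<nu> K u p = (SUP x \<in> {x \<in> K. x \<bullet> \<nu> = p}. ereal (x \<bullet> u))"

text \<open>In \<^typ>\<open>ereal\<close>, \<open>\<infinity> + -\<infinity> = \<infinity>\<close>; here \<open>-\<infinity>\<close> must absorb every summand.\<close>

definition lower_plus :: "ereal \<Rightarrow> ereal \<Rightarrow> ereal" where
  "lower_plus a b = (if a = -\<infinity> \<or> b = -\<infinity> then -\<infinity> else a + b)"

definition partial_sup_convolution ::
  "('a \<Rightarrow> real \<Rightarrow> ereal) \<Rightarrow> ('a \<Rightarrow> real \<Rightarrow> ereal) \<Rightarrow> 'a \<Rightarrow> real \<Rightarrow> ereal" where
  "partial_sup_convolution g h u p =
     (SUP (p\<^sub>1, p\<^sub>2) \<in> {(p\<^sub>1, p\<^sub>2). p\<^sub>1 + p\<^sub>2 = p}. lower_plus (g u p\<^sub>1) (h u p\<^sub>2))"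

end

theory Submission
  imports Defs
begin

text \<open>Since inner products are additive, writing z = x + y with x in K and y in L splits both
  the height of z along \<nu> and its value against u. Hence the slice of K + L at height p is the
  union, over p1 + p2 = p, of the Minkowski sums of the slices of K and L at heights p1 and p2, and
  taking suprema gives the formula. Splitting a point gives
  \<open>slicing_support_set_plus_le\<close>; adding maximisers of the two slices gives
  \<open>lower_plus_slicing_support_le\<close>.\<close>

lemma slicing_support_upper:
  assumes "x \<in> K"
  shows "ereal (x \<bullet> u) \<le> slicing_support \<nu> K u (x \<bullet> \<nu>)"
  unfolding slicing_support_def using assms by (intro SUP_upper) simp

text \<open>A value other than -\<infinity> forces the slice to be nonempty. The slice is also
  compact, being cut from K by a closed hyperplane, so a continuous functional attains its maximum
  there. In particular the value is then a real number.\<close>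

lemma slicing_support_attained:
  assumes "compact K" and "slicing_support \<nu> K u p \<noteq> -\<infinity>"
  obtains x where "x \<in> K" and "x \<bullet> \<nu> = p" and "slicing_support \<nu> K u p = ereal (x \<bullet> u)"
proof -
  let ?S = "{x \<in> K. x \<bullet> \<nu> = p}"
  have "?S \<noteq> {}"
    using assms(2) unfolding slicing_support_def by (metis SUP_empty bot_ereal_def)
  moreover have "compact ?S"
  proof -
    have "?S = K \<inter> {x. \<nu> \<bullet> x = p}"
      by (auto simp: inner_commute)
    then show ?thesis
      using assms(1) closed_hyperplane by (metis compact_Int_closed)
  qed
  moreover have "continuous_on ?S (\<lambda>x. x \<bullet> u)"
    by (intro continuous_intros)
  ultimately obtain x where x: "x \<in> ?S" "\<forall>y\<in>?S. y \<bullet> u \<le> x \<bullet> u"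
    using continuous_attains_sup by blast
  have "slicing_support \<nu> K u p = ereal (x \<bullet> u)"
    unfolding slicing_support_def
    by (rule antisym) (use x in \<open>auto intro!: SUP_least SUP_upper\<close>)
  with x(1) show thesis
    by (intro that) simp_all
qed

text \<open>Real lower bounds keep both summands away from -\<infinity>, so the absorbing case of
  \<open>lower_plus\<close> cannot occur.\<close>

lemma lower_plus_ge:
  assumes "ereal a \<le> A" and "ereal b \<le> B"
  shows "ereal (a + b) \<le> lower_plus A B"
  using add_mono[OF assms] assms by (auto simp: lower_plus_def)

lemma slicing_support_set_plus_le:
  "slicing_support \<nu> (K + L) u p
    \<le> partial_sup_convolution (slicing_support \<nu> K) (slicing_support \<nu> L) u p"
  unfolding slicing_support_def[of \<nu> "K + L"]
proof (rule SUP_least)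
  fix z assume "z \<in> {x \<in> K + L. x \<bullet> \<nu> = p}"
  then obtain x y where xy: "x \<in> K" "y \<in> L" "z = x + y" "x \<bullet> \<nu> + y \<bullet> \<nu> = p"
    by (auto simp: inner_add_left elim!: set_plus_elim)
  have "ereal (z \<bullet> u)
      \<le> lower_plus (slicing_support \<nu> K u (x \<bullet> \<nu>)) (slicing_support \<nu> L u (y \<bullet> \<nu>))"
    unfolding xy(3) inner_add_left by (intro lower_plus_ge slicing_support_upper xy)
  then show "ereal (z \<bullet> u)
      \<le> partial_sup_convolution (slicing_support \<nu> K) (slicing_support \<nu> L) u p"
    unfolding partial_sup_convolution_def
    \<comment> \<open>The heights of the two summands form an admissible pair, as they add up to
      p.\<close>
    by (intro SUP_upper2[where i = "(x \<bullet> \<nu>, y \<bullet> \<nu>)"]) (simp_all add: xy)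
qed

text \<open>If either slice is empty, the left side is -\<infinity>. Otherwise maximisers x and y
  exist by compactness, and x + y is a point of K + L at height p + q that competes in the supremum
  on the right.\<close>

lemma lower_plus_slicing_support_le:
  assumes "compact K" and "compact L"
  shows "lower_plus (slicing_support \<nu> K u p) (slicing_support \<nu> L u q)
    \<le> slicing_support \<nu> (K + L) u (p + q)"
proof (cases "slicing_support \<nu> K u p = -\<infinity> \<or> slicing_support \<nu> L u q = -\<infinity>")
  case True
  then show ?thesis
    by (auto simp: lower_plus_def)
next
  case False
  obtain x where x: "x \<in> K" "x \<bullet> \<nu> = p" "slicing_support \<nu> K u p = ereal (x \<bullet> u)"
    using slicing_support_attained assms(1) False by blast
  obtain y where y: "y \<in> L" "y \<bullet> \<nu> = q" "slicing_support \<nu> L u q = ereal (y \<bullet> u)"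
    using slicing_support_attained assms(2) False by blast
  have "ereal ((x + y) \<bullet> u) \<le> slicing_support \<nu> (K + L) u ((x + y) \<bullet> \<nu>)"
    using x(1) y(1) by (intro slicing_support_upper set_plus_intro)
  with x y show ?thesis
    by (simp add: lower_plus_def inner_add_left)
qed

theorem corollary4:
  fixes K L :: "(real ^ 'n) set" and \<nu> :: "real ^ 'n"
  assumes "convex_body K" and "convex_body L" and "\<nu> \<in> sphere 0 1"
  shows "\<forall>u \<in> orth_hyperplane \<nu>. \<forall>p.
    slicing_support \<nu> (K + L) u p =
      partial_sup_convolution (slicing_support \<nu> K) (slicing_support \<nu> L) u p"
proof (intro ballI allI antisym slicing_support_set_plus_le)
  \<comment> \<open>Only the direction \<ge> is left; it is checked for each pair of heights in the
    supremum.\<close>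
  fix u p
  have "compact K" "compact L"
    using assms by (simp_all add: convex_body_def)
  then show "partial_sup_convolution (slicing_support \<nu> K) (slicing_support \<nu> L) u p
      \<le> slicing_support \<nu> (K + L) u p"
    unfolding partial_sup_convolution_def
    by (auto intro!: SUP_least lower_plus_slicing_support_le)
qed

end
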